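(* Let $\Phi(z)=\sum_{j=0}^\infty u_jz^j$ be a power series convergent for $|z|<1$, with $|u_j|=O(1)$. Let $k\ge0$ and $1>\gamma_1>\gamma_2>\cdots>\gamma_k>0$. Write $z=e^{-u+i\theta}$ with $u>0$ and $\theta\in(-\pi,\pi]$. Suppose that $$\Phi(z)=\sum_{r=1}^kA_r(u-i\theta)^{-\gamma_r}+O(1)\quad\text{as }u,\theta\to0,$$ where $A_1,\dots,A_k$ are real constants. Then for any $\epsilon>0$, $$\sum_{j=0}^{n-1}u_j=\sum_{r=1}^k\frac{A_r}{\Gamma(1+\gamma_r)}n^{\gamma_r}+O(n^\epsilon)\quad\text{as }n\to\infty.$$
   Context: Complex powers $(u-i\theta)^{-\gamma}$ with $u>0$ are taken with the principal branch. The limit $u,\theta\to0$ means $u\to0^+$ and $\theta\to0$ (from both sides), i.e. $z\to1$ within the open unit disk. *)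

theory Defs
  imports "HOL-Analysis.Analysis" "HOL-Library.Landau_Symbols"
begin

end

theory Submission
  imports Defs
begin

text \<open>
  Subtracting \<open>A_r (1 - z)^(- \<gamma>_r)\<close> from \<open>\<Phi>\<close> leaves a power series \<open>D\<close> with bounded coefficients
  \<open>d_j\<close> that is bounded near \<open>z = 1\<close>; the partial sums of the subtracted series are explicit ratios of
  Gamma values, which log-convexity of Gamma compares with \<open>n^\<gamma>_r\<close>. To bound the partial sums
  \<open>S_n\<close> of \<open>d\<close>, integrate \<open>e^(-in\<theta>) D(z) / (1 - z)\<close> over \<open>|z| = e^(-1/n)\<close> against the tent
  \<open>max 0 (\<delta> - |\<theta>|)\<close>, which only sees a neighbourhood of \<open>1\<close>; the integral is \<open>O(log n)\<close>.
  In terms of \<open>a_m = S_(m+1) e^(-m/n)\<close> it is \<open>\<Sum>m. a_m \<tau>(m - n)\<close>, where the tent coefficients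
  \<open>\<tau>(k)\<close> are nonnegative and \<open>O(1/k^2)\<close>. Since \<open>a\<close> is Lipschitz and \<open>O(n)\<close>, replacing \<open>a_m\<close> by
  \<open>a_n\<close> costs \<open>O(n^\<epsilon>)\<close>, and positivity of \<open>\<tau>\<close> turns the bound on \<open>a_n \<Sum>k. \<tau>(k)\<close> into one on
  \<open>a_n\<close> because \<open>\<tau>(0) = \<delta>^2\<close>; no Fourier inversion is needed.
\<close>

section \<open>Comparing powers of \<open>w\<close> with powers of
  \<open>1 - exp (-w)\<close>\<close>

text \<open>First-order Taylor expansion with remainder. The radius \<open>1/4\<close> turns the
  quadratic remainder into at most half of \<open>norm w\<close>, which makes
  \<open>1 - exp (-w)\<close> comparable to \<open>w\<close>.\<close>

lemma norm_one_minus_exp_minus: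
  fixes w :: complex
  assumes "norm w \<le> 1/4"
  shows "norm (1 - exp (-w) - w) \<le> 2 * (norm w)\<^sup>2"
    and "norm (1 - exp (-w) - w) \<le> norm w / 2"
    and "norm w / 2 \<le> norm (1 - exp (-w))"
proof -
  have "norm (exp (-w) - (\<Sum>k\<le>1. (-w) ^ k / fact k)) \<le> exp \<bar>Re (-w)\<bar> * norm (-w) ^ Suc 1 / fact 1"
    by (rule Taylor_exp)
  also have "exp \<bar>Re (-w)\<bar> \<le> 2"
    using abs_Re_le_cmod[of w] assms by (intro exp_half_le2[THEN order.trans[rotated]]) auto
  finally have "norm (exp (-w) - (1 - w)) \<le> 2 * (norm w)\<^sup>2"
    by (simp add: power2_eq_square mult_right_mono)
  moreover have "exp (-w) - (1 - w) = - (1 - exp (-w) - w)" by simp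
  ultimately show 1: "norm (1 - exp (-w) - w) \<le> 2 * (norm w)\<^sup>2"
    by (metis norm_minus_cancel)
  have "2 * (norm w)\<^sup>2 \<le> norm w / 2"
    using mult_right_mono[OF assms, of "norm w"] by (simp add: power2_eq_square)
  with 1 show 2: "norm (1 - exp (-w) - w) \<le> norm w / 2" by linarith
  show "norm w / 2 \<le> norm (1 - exp (-w))"
    using 2 norm_triangle_ineq2[of w "w - (1 - exp (-w))"]
    by (simp add: norm_minus_commute)
qed

text \<open>With z = exp(-w) this exchanges the singular term in u - i\<theta> for one in 1 - z. The
  power has derivative of order |w|^(-g-1) and the two points are O(|w|^2) apart, so the change is
  O(|w|^(1-g)), bounded since g < 1.\<close>

lemma norm_powr_minus_diff_le:
  fixes w :: complex and g :: real
  assumes w: "Re w > 0" "norm w \<le> 1/4" and g: "0 < g" "g < 1"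
  shows "norm (w powr (- of_real g) - (1 - exp (-w)) powr (- of_real g)) \<le> 8"
proof -
  \<comment> \<open>Mean value inequality on a convex set containing both points and bounded away from \<open>0\<close>.\<close>
  define S where "S = {z. Re z > 0} \<inter> cball w (norm w / 2)"
  define f' where "f' z = - complex_of_real g * z powr (- of_real g - 1)" for z :: complex
  have w0: "norm w > 0" using w by auto
  have "convex S" unfolding S_def
    by (intro convex_Int convex_halfspace_Re_gt convex_cball)
  have deriv: "((\<lambda>z. z powr (- complex_of_real g)) has_field_derivative f' z) (at z within S)"
    if "z \<in> S" for z
  proof -
    have "z \<notin> \<real>\<^sub>\<le>\<^sub>0" using that by (auto simp: S_def complex_nonpos_Reals_iff)
    then show ?thesis unfolding f'_def
      by (rule has_field_derivative_at_within[OF has_field_derivative_powr])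
  qed
  have bound: "norm (f' z) \<le> (norm w / 2) powr (- g - 1)" if "z \<in> S" for z
  proof -
    have "norm w / 2 \<le> norm z"
      using that norm_triangle_ineq2[of w "w - z"] by (auto simp: S_def dist_norm)
    then have "norm z powr (- g - 1) \<le> (norm w / 2) powr (- g - 1)"
      using g w0 by (intro powr_mono2') auto
    moreover have "z \<noteq> 0" using that by (auto simp: S_def)
    then have "norm (z powr (- of_real g - 1)) = norm z powr (- g - 1)"
      by (simp add: powr_def)
    moreover have "g * norm z powr (- g - 1) \<le> 1 * norm z powr (- g - 1)"
      using g by (intro mult_right_mono) auto
    ultimately show ?thesis using g by (simp add: f'_def norm_mult)
  qed
  \<comment> \<open>This puts \<open>1 - exp (-w)\<close> in the right half-plane, away from the
    branch cut.\<close>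
  have "exp (- Re w) < 1" using w by simp
  moreover have "Re (exp (-w)) \<le> exp (- Re w)"
    using complex_Re_le_cmod[of "exp (-w)"] by simp
  ultimately have "Re (1 - exp (-w)) > 0" by (simp del: exp_less_one_iff)
  then have S: "w \<in> S" "1 - exp (-w) \<in> S"
    using w norm_one_minus_exp_minus(2)[OF w(2)]
    by (auto simp: S_def dist_norm norm_minus_commute)
  have "norm (w powr (- of_real g) - (1 - exp (-w)) powr (- of_real g))
      \<le> (norm w / 2) powr (- g - 1) * norm (w - (1 - exp (-w)))"
    using field_differentiable_bound[OF \<open>convex S\<close> deriv bound S] by simp
  also have "\<dots> \<le> (norm w / 2) powr (- g - 1) * (2 * (norm w)\<^sup>2)"
    using norm_one_minus_exp_minus(1)[OF w(2)]
    by (intro mult_left_mono) (auto simp: norm_minus_commute)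
  \<comment> \<open>The constant 8 arises from writing 2|w|^2 as 8(|w|/2)^2.\<close>
  also have "\<dots> = 8 * ((norm w / 2) powr (- g - 1) * (norm w / 2) powr 2)"
    using w0 by (simp add: power2_eq_square powr_numeral)
  also have "(norm w / 2) powr (- g - 1) * (norm w / 2) powr 2 = (norm w / 2) powr (1 - g)"
    unfolding powr_add[symmetric] by simp
  also have "8 * (norm w / 2) powr (1 - g) \<le> 8 * 1"
    using g w0 w by (intro mult_left_mono powr_le1) auto
  finally show ?thesis by simp
qed

section \<open>Binomial coefficients, their partial sums and Gamma ratios\<close>

text \<open>The summands are the coefficients of (1 - x)^(-a). Taking partial sums amounts to
  multiplying by 1/(1 - x), which raises a to a + 1.\<close>

lemma sum_pochhammer_over_fact:
  fixes a :: "'a :: field_char_0"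
  shows "(\<Sum>j<Suc n. pochhammer a j / fact j) = pochhammer (a + 1) n / fact n"
proof (induction n)
  case (Suc n)
  have "pochhammer a (Suc n) = a * pochhammer (a + 1) n"
    by (rule pochhammer_rec)
  moreover have "pochhammer (a + 1) (Suc n) = pochhammer (a + 1) n * (a + 1 + of_nat n)"
    by (rule pochhammer_Suc)
  moreover have "(1 + of_nat n :: 'a) \<noteq> 0"
    by (metis of_nat_Suc of_nat_neq_0)
  ultimately show ?case
    using Suc.IH by (simp add: divide_simps) (simp add: algebra_simps)
qed simp

lemma pochhammer_over_fact_le_1:
  fixes a :: real
  assumes "0 \<le> a" "a \<le> 1"
  shows "0 \<le> pochhammer a j / fact j" "pochhammer a j / fact j \<le> 1"
proof -
  show "0 \<le> pochhammer a j / fact j"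
    using assms by (intro divide_nonneg_nonneg) (auto simp: pochhammer_prod intro!: prod_nonneg)
  have "pochhammer a j \<le> (\<Prod>i<j. 1 + real i)"
    unfolding pochhammer_prod atLeast0LessThan using assms by (intro prod_mono) auto
  also have "\<dots> = fact j" by (simp add: fact_prod_Suc atLeast0LessThan)
  finally show "pochhammer a j / fact j \<le> 1" by simp
qed

text \<open>Log-convexity between \<open>x\<close> and \<open>x + 1\<close>, combined with Gamma(x +
  1) = x Gamma(x).\<close>

lemma Gamma_shift_le:
  fixes x a :: real
  assumes "x > 0" "0 \<le> a" "a \<le> 1"
  shows "Gamma (x + a) \<le> x powr a * Gamma x"
proof -
  have "(ln \<circ> Gamma) ((1 - a) *\<^sub>R x + a *\<^sub>R (x + 1)) \<le> (1 - a) * (ln \<circ> Gamma) x + a * (ln \<circ> Gamma) (x + 1)"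
    using assms by (intro convex_onD[OF log_convex_Gamma_real]) auto
  moreover have "(1 - a) *\<^sub>R x + a *\<^sub>R (x + 1) = x + a" by (simp add: algebra_simps)
  moreover have "Gamma (x + 1) = x * Gamma x" using assms by (intro Gamma_plus1) auto
  ultimately have "ln (Gamma (x + a)) \<le> (1 - a) * ln (Gamma x) + a * (ln x + ln (Gamma x))"
    using assms Gamma_real_pos[of x] by (simp add: ln_mult_pos)
  also have "\<dots> = ln (x powr a * Gamma x)"
    using assms Gamma_real_pos[of x] by (simp add: ln_mult_pos algebra_simps)
  finally show ?thesis
    using assms Gamma_real_pos[of x] Gamma_real_pos[of "x + a"] by simp
qed

text \<open>\<open>Gamma_shift_le\<close> at \<open>x\<close> gives the upper bound. Applied at
  \<open>x + a\<close> with shift \<open>1 - a\<close> it reaches \<open>x + 1\<close>, which gives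
  the lower bound.\<close>

lemma Gamma_ratio_minus_powr_bound:
  fixes x a :: real
  assumes x: "x \<ge> 1" and a: "0 < a" "a < 1"
  shows "\<bar>Gamma (x + a) / Gamma x - x powr a\<bar> \<le> 1"
proof -
  have Gx: "Gamma x > 0" using x by auto
  have "Gamma (x + a) / Gamma x \<le> x powr a"
    using Gamma_shift_le[of x a] x a Gx by (simp add: field_simps)
  moreover have "x powr a - 1 \<le> Gamma (x + a) / Gamma x"
  proof -
    have "x \<notin> \<int>\<^sub>\<le>\<^sub>0" using x nonpos_Ints_nonpos[of x] by linarith
    then have "x * Gamma x = Gamma ((x + a) + (1 - a))"
      using Gamma_plus1[of x] by (simp add: add.commute)
    also have "\<dots> \<le> (x + a) powr (1 - a) * Gamma (x + a)"
      using x a by (intro Gamma_shift_le) auto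
    finally have "x \<le> (x + a) powr (1 - a) * (Gamma (x + a) / Gamma x)"
      using Gx by (simp add: field_simps)
    then have "x * (x + a) powr (a - 1)
        \<le> (x + a) powr (1 - a) * (Gamma (x + a) / Gamma x) * (x + a) powr (a - 1)"
      by (intro mult_right_mono) auto
    also have "\<dots> = Gamma (x + a) / Gamma x * ((x + a) powr (1 - a) * (x + a) powr (a - 1))"
      by (simp add: mult_ac)
    also have "\<dots> = Gamma (x + a) / Gamma x"
      using x a by (simp flip: powr_add)
    finally have "x * (x + a) powr (a - 1) \<le> Gamma (x + a) / Gamma x" .
    \<comment> \<open>The lower bound x(x+a)^(a-1) equals (x+a)^a - a(x+a)^(a-1), which is at least
      x^a - 1.\<close>
    moreover have "(x + a) powr a = (x + a) * (x + a) powr (a - 1)"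
      using x a powr_add[of "x + a" 1 "a - 1"] by simp
    moreover have "a * (x + a) powr (a - 1) \<le> 1 * 1"
      using x a powr_mono2'[of "a - 1" 1 "x + a"] by (intro mult_mono) auto
    moreover have "x powr a \<le> (x + a) powr a"
      using x a by (intro powr_mono2) auto
    ultimately show ?thesis by (simp add: algebra_simps)
  qed
  ultimately show ?thesis by linarith
qed

lemma sum_pochhammer_asymptotic:
  fixes g :: real
  assumes g: "0 < g" "g < 1" and n: "n > 0"
  shows "\<bar>(\<Sum>j<n. pochhammer g j / fact j) - real n powr g / Gamma (1 + g)\<bar> \<le> 1 / Gamma (1 + g)"
proof -
  obtain m where m: "n = Suc m" using n by (cases n) auto
  have G: "Gamma (1 + g) > 0" using g by auto
  have "(\<Sum>j<n. pochhammer g j / fact j) = pochhammer (g + 1) m / fact m"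
    unfolding m by (rule sum_pochhammer_over_fact)
  also have "\<dots> = (Gamma (real n + g) / Gamma (real n)) / Gamma (1 + g)"
    using g Gamma_fact[of m, where 'a = real]
    by (subst pochhammer_Gamma) (auto elim!: nonpos_Ints_cases' simp: m add_ac)
  finally have "(\<Sum>j<n. pochhammer g j / fact j) - real n powr g / Gamma (1 + g)
      = (Gamma (real n + g) / Gamma (real n) - real n powr g) / Gamma (1 + g)"
    by (simp add: diff_divide_distrib)
  moreover have "\<bar>Gamma (real n + g) / Gamma (real n) - real n powr g\<bar> \<le> 1"
    using g n by (intro Gamma_ratio_minus_powr_bound) auto
  ultimately show ?thesis using G by (simp add: divide_right_mono)
qed

lemma pochhammer_sums_one_minus_powr:
  fixes z :: complex and g :: real
  assumes "norm z < 1"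
  shows "(\<lambda>j. of_real (pochhammer g j / fact j) * z ^ j) sums (1 - z) powr (- of_real g)"
proof -
  have "(\<lambda>j. ((- of_real g) gchoose j) * (-z) ^ j) sums (1 + (-z)) powr (- of_real g)"
    using assms by (intro gen_binomial_complex) simp
  moreover have "((- of_real g) gchoose j) * (-z) ^ j = of_real (pochhammer g j / fact j) * z ^ j" for j
  proof -
    have "(-1) ^ j * (-1) ^ j = (1 :: complex)" by (simp flip: power_mult_distrib)
    then show ?thesis
      by (simp add: gbinomial_pochhammer power_minus[of z] pochhammer_of_real)
  qed
  ultimately show ?thesis by simp
qed

section \<open>Generating function of the partial sums\<close>

text \<open>Cauchy product with the geometric series. The coefficient of z^m collects the indices 0
  to m, hence \<open>Suc m\<close>.\<close>

lemma partial_sums_mult_power_sums: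
  fixes d :: "nat \<Rightarrow> 'a :: {real_normed_field, banach}"
  assumes "summable (\<lambda>j. norm (d j * z ^ j))" "norm z < 1"
  shows "(\<lambda>m. (\<Sum>j<Suc m. d j) * z ^ m) sums ((\<Sum>j. d j * z ^ j) / (1 - z))"
proof -
  have "(\<lambda>m. \<Sum>j\<le>m. (d j * z ^ j) * z ^ (m - j)) sums ((\<Sum>j. d j * z ^ j) * (\<Sum>j. z ^ j))"
    using assms by (intro Cauchy_product_sums) (auto simp: norm_power intro: summable_geometric)
  moreover have "(\<Sum>j\<le>m. (d j * z ^ j) * z ^ (m - j)) = (\<Sum>j<Suc m. d j) * z ^ m" for m
    by (auto simp: sum_distrib_right lessThan_Suc_atMost mult.assoc simp flip: power_add
             intro!: sum.cong)
  ultimately show ?thesis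
    using suminf_geometric[OF assms(2)] by simp
qed

text \<open>The previous lemma, applied to \<open>norm (d j)\<close> at \<open>norm z\<close>,
  supplies a convergent majorant.\<close>

lemma summable_norm_partial_sums_mult_power:
  fixes d :: "nat \<Rightarrow> 'a :: {real_normed_field, banach}"
  assumes "summable (\<lambda>j. norm (d j * z ^ j))" "norm z < 1"
  shows "summable (\<lambda>m. norm ((\<Sum>j<Suc m. d j) * z ^ m))"
proof (rule summable_comparison_test')
  show "summable (\<lambda>m. (\<Sum>j<Suc m. norm (d j)) * norm z ^ m)"
    using assms
    by (intro sums_summable[OF partial_sums_mult_power_sums]) (auto simp: norm_mult norm_power)
  show "norm (norm ((\<Sum>j<Suc m. d j) * z ^ m)) \<le> (\<Sum>j<Suc m. norm (d j)) * norm z ^ m" for m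
    using norm_sum[of d "{..<Suc m}"]
    by (simp only: norm_mult norm_power real_norm_def abs_mult abs_norm_cancel power_abs)
       (intro mult_right_mono, auto)
qed

section \<open>Fourier coefficients of the tent function\<close>

text \<open>This is the integral of max(0, \<delta> - |t|) e^(ikt) over the real line. The tent is
  even, so natural \<open>k\<close> suffice; the case \<open>k = 0\<close> is the limit of the
  general formula, which would otherwise evaluate to 0.\<close>

definition tent_coeff :: "real \<Rightarrow> nat \<Rightarrow> real" where
  "tent_coeff \<delta> k = (if k = 0 then \<delta>\<^sup>2 else 2 * (1 - cos (real k * \<delta>)) / (real k)\<^sup>2)"

lemma has_integral_tent_coeff:
  assumes "\<delta> \<ge> 0"
  shows "((\<lambda>t. (\<delta> - t) * (2 * cos (real k * t))) has_integral tent_coeff \<delta> k) {0..\<delta>}"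
proof (cases "k = 0")
  case True
  have "((\<lambda>t. (\<delta> - t) * 2) has_integral (2 * \<delta> * \<delta> - \<delta>\<^sup>2) - (2 * \<delta> * 0 - 0\<^sup>2)) {0..\<delta>}"
    using assms
    by (intro fundamental_theorem_of_calculus)
       (auto intro!: derivative_eq_intros simp flip: has_real_derivative_iff_has_vector_derivative)
  with True show ?thesis by (simp add: tent_coeff_def power2_eq_square)
next
  case False
  \<comment> \<open>Antiderivative found by integration by parts.\<close>
  define F where "F t = 2 * ((\<delta> - t) * sin (real k * t) / real k - cos (real k * t) / (real k)\<^sup>2)" for t
  have "(F has_real_derivative (\<delta> - t) * (2 * cos (real k * t))) (at t within {0..\<delta>})" for t
    unfolding F_def using False
    by (auto intro!: derivative_eq_intros simp: field_simps power2_eq_square)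
  then have "((\<lambda>t. (\<delta> - t) * (2 * cos (real k * t))) has_integral F \<delta> - F 0) {0..\<delta>}"
    using assms
    by (intro fundamental_theorem_of_calculus)
       (auto simp flip: has_real_derivative_iff_has_vector_derivative)
  moreover have "F \<delta> - F 0 = tent_coeff \<delta> k"
    using False by (simp add: F_def tent_coeff_def field_simps)
  ultimately show ?thesis by simp
qed

lemma tent_coeff_nonneg: "0 \<le> tent_coeff \<delta> k"
  by (simp add: tent_coeff_def)

lemma tent_coeff_le: "k > 0 \<Longrightarrow> tent_coeff \<delta> k \<le> 4 / (real k)\<^sup>2"
proof -
  assume "k > 0"
  moreover have "1 - cos x \<le> 2" for x :: real
    using cos_ge_minus_one[of x] by linarith
  then have "2 * (1 - cos (real k * \<delta>)) \<le> 2 * 2"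
    by (intro mult_left_mono) auto
  ultimately show ?thesis by (simp add: tent_coeff_def divide_right_mono)
qed

lemma summable_tent_coeff: "summable (tent_coeff \<delta>)"
proof (rule summable_comparison_test_ev)
  show "summable (\<lambda>k. 4 * inverse (real k ^ 2))"
    by (intro summable_mult inverse_power_summable) auto
  show "\<forall>\<^sub>F k in sequentially. norm (tent_coeff \<delta> k) \<le> 4 * inverse (real k ^ 2)"
    using eventually_gt_at_top[of 0]
    by eventually_elim
      (use tent_coeff_le tent_coeff_nonneg in \<open>auto simp: divide_inverse\<close>)
qed

section \<open>Sums over distances, interpolation and increments\<close>

text \<open>Since subtraction on \<open>nat\<close> truncates, \<open>(m - n) + (n - m)\<close> is the distance \<open>|m - n|\<close>.\<close>

lemma two_sided_summable:
  fixes g :: "nat \<Rightarrow> real"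
  assumes "summable g" "\<And>k. g k \<ge> 0"
  shows "summable (\<lambda>m. g ((m - n) + (n - m)))"
    and "(\<Sum>m. g ((m - n) + (n - m))) \<le> 2 * suminf g"
proof -
  let ?h = "\<lambda>m. g ((m - n) + (n - m))"
  have shift: "(\<lambda>m. ?h (m + n)) = g" by auto
  then show sm: "summable ?h"
    using assms(1) summable_iff_shift[of ?h n] by simp
  \<comment> \<open>Reflecting m to n - 1 - m lists the terms left of \<open>n\<close> as g 1, ...,
    g n.\<close>
  have "(\<Sum>m<n. ?h m) = (\<Sum>m<n. g (Suc m))"
    by (subst sum.nat_diff_reindex[symmetric]) (auto intro!: sum.cong)
  also have "\<dots> \<le> (\<Sum>m<Suc n. g m)"
    using assms(2) by (simp only: sum.lessThan_Suc_shift) simp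
  also have "\<dots> \<le> suminf g"
    using assms by (intro sum_le_suminf) auto
  finally show "suminf ?h \<le> 2 * suminf g"
    using suminf_split_initial_segment[OF sm, of n] shift by simp
qed

text \<open>Used to merge a bound linear in the distance with a uniform one, at the cost of only a
  small power of the latter.\<close>

lemma min_le_powr_interpolation:
  fixes x y z e :: real
  assumes "x \<le> y" "x \<le> z" "0 \<le> x" "0 \<le> e" "e \<le> 1"
  shows "x \<le> y powr (1 - e) * z powr e"
proof -
  have "x = x powr (1 - e) * x powr e"
    using assms by (cases "x = 0") (auto simp flip: powr_add)
  also have "\<dots> \<le> y powr (1 - e) * z powr e"
    using assms by (intro mult_mono powr_mono2) auto
  finally show ?thesis .
qed

lemma norm_diff_le_of_step:
  fixes a :: "nat \<Rightarrow> 'a :: real_normed_vector"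
  assumes "\<And>m. norm (a (Suc m) - a m) \<le> B"
  shows "norm (a m - a n) \<le> B * real ((m - n) + (n - m))"
proof -
  have *: "norm (a (n + k) - a n) \<le> B * real k" for n k
  proof (induction k)
    case (Suc k)
    have "norm (a (n + Suc k) - a n) \<le> norm (a (Suc (n + k)) - a (n + k)) + norm (a (n + k) - a n)"
      using norm_triangle_ineq[of "a (Suc (n + k)) - a (n + k)" "a (n + k) - a n"] by simp
    with Suc assms[of "n + k"] show ?case by (simp add: algebra_simps)
  qed simp
  show ?thesis
    using *[of n "m - n"] *[of m "n - m"]
    by (cases "n \<le> m") (auto simp: norm_minus_commute)
qed

section \<open>Localisation by the tent weight\<close>

text \<open>\<open>G\<close> combines the values at t and -t, so only cosines on
  \<open>{0..\<delta>}\<close> appear. Its integral against \<open>\<delta> - t\<close> is a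
  weighted sum of the \<open>a m\<close>: logarithmic in size by \<open>G_bd\<close>, and close to
  \<open>a n\<close> times the total weight by \<open>step\<close> and \<open>bd\<close>.\<close>

lemma tent_localisation:
  fixes a :: "nat \<Rightarrow> complex" and G :: "real \<Rightarrow> complex"
  assumes sm: "summable (\<lambda>m. norm (a m))"
    and step: "\<And>m. norm (a (Suc m) - a m) \<le> B"
    and bd: "\<And>m. norm (a m) \<le> B * N"
    and \<delta>: "\<delta> > 0" and v: "v > 0" and e: "0 < e" "e < 1" and N: "N > 0"
    and G: "\<And>t. t \<in> {0..\<delta>} \<Longrightarrow>
              (\<lambda>m. a m * of_real (2 * cos (real ((m - n) + (n - m)) * t))) sums G t"
    and G_bd: "\<And>t. t \<in> {0..\<delta>} \<Longrightarrow> norm (G t) \<le> R / (v + t)"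
  shows "\<delta>\<^sup>2 * norm (a n) \<le> \<delta> * R * ln ((v + \<delta>) / v)
           + 16 * B * N powr e * (\<Sum>k. real k powr (- 1 - e))"
proof -
  let ?\<kappa> = "\<lambda>m. (m - n) + (n - m)"
  define \<tau> where "\<tau> m = tent_coeff \<delta> (?\<kappa> m)" for m
  have B: "B \<ge> 0" using step[of 0] norm_ge_zero order.trans by blast
  have "0 \<le> R / (v + 0)" using G_bd[of 0] \<delta> by (intro order.trans[OF norm_ge_zero]) auto
  then have R: "R \<ge> 0" using v by (simp add: zero_le_divide_iff)
  have sm_\<tau>: "summable \<tau>"
    unfolding \<tau>_def by (intro two_sided_summable(1) summable_tent_coeff tent_coeff_nonneg)
  have \<tau>_nonneg: "\<tau> m \<ge> 0" for m by (simp add: \<tau>_def tent_coeff_nonneg)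

  define f where "f m t = a m * of_real ((\<delta> - t) * (2 * cos (real (?\<kappa> m) * t)))" for m t
  define g where "g t = of_real (\<delta> - t) * G t" for t
  have f_sums: "(\<lambda>m. f m t) sums g t" if "t \<in> {0..\<delta>}" for t
    using sums_mult[OF G[OF that], of "of_real (\<delta> - t)"] by (simp add: f_def g_def mult_ac)
  have f_bd: "norm (f m t) \<le> 2 * \<delta> * norm (a m)" if "t \<in> {0..\<delta>}" for m t
  proof -
    have "\<bar>(\<delta> - t) * (2 * cos (real (?\<kappa> m) * t))\<bar> \<le> \<delta> * 2"
      unfolding abs_mult using that by (intro mult_mono) auto
    then have "norm (a m) * \<bar>(\<delta> - t) * (2 * cos (real (?\<kappa> m) * t))\<bar> \<le> norm (a m) * (\<delta> * 2)"
      by (intro mult_left_mono) auto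
    then show ?thesis unfolding f_def norm_mult norm_of_real by (simp add: mult_ac)
  qed
  \<comment> \<open>Uniform convergence by the M-test allows term-by-term integration.\<close>
  have unif: "uniform_limit {0..\<delta>} (\<lambda>n t. \<Sum>m<n. f m t) g sequentially"
  proof (rule uniform_limit_cong'[THEN iffD1])
    show "uniform_limit {0..\<delta>} (\<lambda>n t. \<Sum>m<n. f m t) (\<lambda>t. \<Sum>m. f m t) sequentially"
      using f_bd sm by (intro Weierstrass_m_test[of _ _ "\<lambda>m. 2 * \<delta> * norm (a m)"]) (auto intro: summable_mult)
  qed (use f_sums in \<open>auto simp: sums_iff\<close>)
  have cont: "continuous_on {0..\<delta>} (\<lambda>t. \<Sum>m<n. f m t)" for n
    unfolding f_def by (intro continuous_intros)
  obtain I J where I: "\<And>n. ((\<lambda>t. \<Sum>m<n. f m t) has_integral I n) {0..\<delta>}"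
    and J: "(g has_integral J) {0..\<delta>}" and IJ: "I \<longlonglongrightarrow> J"
    by (rule uniform_limit_integral[OF unif cont]) auto
  have "((\<lambda>t. \<Sum>m<n. f m t) has_integral (\<Sum>m<n. a m * of_real (\<tau> m))) {0..\<delta>}" for n
    unfolding f_def \<tau>_def using \<delta>
    by (intro has_integral_sum has_integral_mult_right has_integral_of_real has_integral_tent_coeff) auto
  then have "I = (\<lambda>n. \<Sum>m<n. a m * of_real (\<tau> m))"
    using I has_integral_unique by blast
  with IJ have J_sums: "(\<lambda>m. a m * of_real (\<tau> m)) sums J" by (simp add: sums_def)

  have "((\<lambda>t. \<delta> * R * (1 / (v + t))) has_integral \<delta> * R * (ln (v + \<delta>) - ln (v + 0))) {0..\<delta>}"
    using v \<delta>
    by (intro has_integral_mult_right fundamental_theorem_of_calculus)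
       (auto intro!: derivative_eq_intros simp flip: has_real_derivative_iff_has_vector_derivative)
  then have "norm J \<le> (\<delta> * R * (ln (v + \<delta>) - ln (v + 0))) \<bullet> 1"
  proof (rule has_integral_norm_bound_integral_component[OF J])
    fix t assume t: "t \<in> {0..\<delta>}"
    have "norm (g t) = (\<delta> - t) * norm (G t)" using t by (simp add: g_def norm_mult del: of_real_diff)
    also have "\<dots> \<le> \<delta> * (R / (v + t))"
      using t G_bd[OF t] \<delta> by (intro mult_mono) auto
    finally show "norm (g t) \<le> (\<delta> * R * (1 / (v + t))) \<bullet> 1" by simp
  qed
  then have J_bd: "norm J \<le> \<delta> * R * ln ((v + \<delta>) / v)"
    using v \<delta> by (simp add: ln_div)

  \<comment> \<open>Interpolating between \<open>2 * B * k\<close> and \<open>2 * B * N\<close> and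
    multiplying by the tent decay 4/k^2 leaves k to the power (1 - e) - 2 = -1 - e, which is
    summable.\<close>
  define h where "h k = 8 * B * N powr e * real k powr (- 1 - e)" for k :: nat
  have sm_z: "summable (\<lambda>k. real k powr (- 1 - e))"
    using e by (simp add: summable_real_powr_iff)
  then have sm_h: "summable h" unfolding h_def by (intro summable_mult)
  have h_nonneg: "h k \<ge> 0" for k using B by (simp add: h_def)
  have diff_bd: "norm ((a n - a m) * of_real (\<tau> m)) \<le> h (?\<kappa> m)" for m
  proof (cases "m = n")
    case False
    define k where "k = ?\<kappa> m"
    have k: "k > 0" using False by (auto simp: k_def)
    have "norm (a n - a m) \<le> B * real k"
      using norm_diff_le_of_step[of a B m n, OF step] by (simp only: k_def norm_minus_commute)
    \<comment> \<open>Weakened to match the constant of the uniform bound, so that the two powers of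
      \<open>2 * B\<close> recombine.\<close>
    also have "\<dots> \<le> 2 * B * real k" using B by (intro mult_right_mono) auto
    finally have "norm (a n - a m) \<le> 2 * B * real k" .
    moreover have "norm (a n - a m) \<le> 2 * B * N"
      using norm_triangle_ineq4[of "a n" "a m"] bd[of n] bd[of m] by simp
    ultimately have "norm (a n - a m) \<le> (2 * B * real k) powr (1 - e) * (2 * B * N) powr e"
      using e by (intro min_le_powr_interpolation) auto
    also have "\<dots> = ((2 * B) powr (1 - e) * (2 * B) powr e) * (real k powr (1 - e) * N powr e)"
      using B N by (simp add: powr_mult mult_ac)
    also have "(2 * B) powr (1 - e) * (2 * B) powr e = 2 * B"
      unfolding powr_add[symmetric] using B by simp
    finally have "norm (a n - a m) * \<tau> m \<le> (2 * B * (real k powr (1 - e) * N powr e)) * (4 / (real k)\<^sup>2)"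
      using tent_coeff_le[OF k] \<tau>_nonneg[of m] B by (intro mult_mono) (auto simp: \<tau>_def k_def)
    also have "\<dots> = 8 * B * N powr e * (real k powr (1 - e) * real k powr (- 2))"
      using k by (simp add: powr_minus powr_numeral divide_inverse)
    also have "\<dots> = h k" unfolding powr_add[symmetric] by (simp add: h_def)
    finally show ?thesis using \<tau>_nonneg[of m] by (simp add: norm_mult k_def)
  qed (use h_nonneg in auto)
  have diff_sums: "(\<lambda>m. (a n - a m) * of_real (\<tau> m)) sums (a n * of_real (suminf \<tau>) - J)"
    using sums_diff[OF sums_mult[OF sums_of_real[OF summable_sums[OF sm_\<tau>]]] J_sums]
    by (simp add: algebra_simps)
  have "norm (\<Sum>m. (a n - a m) * of_real (\<tau> m)) \<le> (\<Sum>m. h (?\<kappa> m))"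
    using diff_bd by (rule norm_suminf_le) (rule two_sided_summable(1)[OF sm_h h_nonneg])
  also have "\<dots> \<le> 2 * suminf h"
    by (rule two_sided_summable(2)[OF sm_h h_nonneg])
  also have "suminf h = 8 * B * N powr e * (\<Sum>k. real k powr (- 1 - e))"
    unfolding h_def using sm_z by (rule suminf_mult)
  finally have D: "norm (a n * of_real (suminf \<tau>) - J) \<le> 16 * B * N powr e * (\<Sum>k. real k powr (- 1 - e))"
    using diff_sums by (simp add: sums_iff)
  \<comment> \<open>Nonnegative weights cannot cancel, so the total weight is at least the central
    one.\<close>
  have "\<delta>\<^sup>2 = \<tau> n" by (simp add: \<tau>_def tent_coeff_def)
  also have "\<dots> \<le> suminf \<tau>"
    using sum_le_suminf[OF sm_\<tau>, of "{n}"] \<tau>_nonneg by auto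
  finally have "\<delta>\<^sup>2 * norm (a n) \<le> suminf \<tau> * norm (a n)"
    by (rule mult_right_mono) simp
  also have "\<dots> = norm (a n * of_real (suminf \<tau>))"
    using \<tau>_nonneg suminf_nonneg[OF sm_\<tau>] by (simp add: norm_mult)
  also have "\<dots> \<le> norm J + norm (a n * of_real (suminf \<tau>) - J)"
    using norm_triangle_ineq[of J "a n * of_real (suminf \<tau>) - J"] by simp
  finally show ?thesis using J_bd D by linarith
qed

section \<open>Partial sums of a series bounded near 1\<close>

text \<open>On the circle of radius r = e^(-1/n) the damping r^n is the constant 1/e, while 1/(1 -
  z) is O(1/(v + |t|)) with v = 1/n. Hence \<open>tent_localisation\<close> applies with B = 2C, N =
  n and R = 8M.\<close>

lemma partial_sums_bigo_of_bounded_near_1: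
  fixes d :: "nat \<Rightarrow> complex"
  assumes d: "\<And>j. norm (d j) \<le> C" and \<delta>: "0 < \<delta>" "\<delta> \<le> 1/8"
    and M: "\<And>v t. \<lbrakk>0 < v; v < \<delta>; \<bar>t\<bar> \<le> \<delta>\<rbrakk> \<Longrightarrow>
              norm (\<Sum>j. d j * exp (- of_real v + \<i> * of_real t) ^ j) \<le> M"
    and e: "0 < e" "e < 1"
  shows "(\<lambda>n. norm (\<Sum>j<n. d j)) \<in> O(\<lambda>n. real n powr e)"
proof -
  define S where "S m = (\<Sum>j<Suc m. d j)" for m
  have C: "C \<ge> 0" using d[of 0] norm_ge_zero order.trans by blast
  define Z where "Z = (\<Sum>k. real k powr (- 1 - e))"
  \<comment> \<open>\<open>exp 1\<close> undoes the damping, \<open>2 / e\<close> comes from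
    bounding the logarithm by a power, and 32C is 16B.\<close>
  define K where "K = exp 1 / \<delta>\<^sup>2 * (\<delta> * (8 * M) * (2 / e) + 32 * C * Z)"
  have "M \<ge> 0" using order.trans[OF norm_ge_zero M[of "\<delta> / 2" 0]] \<delta> by simp
  have main: "norm (S n) \<le> K * real n powr e" if n: "n > 0" "1 / real n < \<delta>" for n
  proof -
    define v where "v = 1 / real n"
    define r where "r = exp (- v)"
    define a where "a m = S m * of_real (r ^ m)" for m
    have v: "0 < v" "v < \<delta>" using n by (auto simp: v_def)
    have r: "0 < r" "r < 1" using v by (auto simp: r_def)
    have "1 + v \<le> exp v" by (rule exp_ge_add_one_self)
    then have "r \<le> 1 / (1 + v)"
      using v by (simp add: r_def exp_minus field_simps)
    also have "\<dots> = real n / (real n + 1)" using n by (simp add: v_def field_simps)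
    finally have "1 / (real n + 1) \<le> 1 - r" by (simp add: field_simps)
    then have r_inv: "1 / (1 - r) \<le> real n + 1" using r by (simp add: field_simps)

    \<comment> \<open>Each of the first m + 1 terms of the geometric series is at least r^m.\<close>
    have r_pow: "real (Suc m) * r ^ m \<le> 1 / (1 - r)" for m
    proof -
      have "real (Suc m) * r ^ m \<le> (\<Sum>i<Suc m. r ^ i)"
        using sum_bounded_below[of "{..<Suc m}" "r ^ m" "\<lambda>i. r ^ i"] r
        by (auto intro!: power_decreasing simp del: sum.lessThan_Suc)
      also have "\<dots> = (1 - r ^ Suc m) / (1 - r)" using r by (subst sum_gp_strict) auto
      also have "\<dots> \<le> 1 / (1 - r)" using r by (intro divide_right_mono) auto
      finally show ?thesis .
    qed
    have S_bd: "norm (S m) \<le> C * real (Suc m)" for m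
      using sum_norm_le[of "{..<Suc m}" d "\<lambda>_. C"] d by (simp add: S_def mult.commute)
    have a_bd': "norm (a m) \<le> C / (1 - r)" for m
    proof -
      have "norm (a m) \<le> C * real (Suc m) * r ^ m"
        unfolding a_def norm_mult using S_bd r C by (intro mult_mono) (auto simp: norm_power)
      also have "\<dots> \<le> C * (1 / (1 - r))"
        using mult_left_mono[OF r_pow C] by (simp only: mult.assoc)
      finally show ?thesis by simp
    qed
    have a_bd: "norm (a m) \<le> 2 * C * real n" for m
    proof -
      have "C * (1 / (1 - r)) \<le> C * (2 * real n)"
        using r_inv n C by (intro mult_left_mono) auto
      with a_bd'[of m] show ?thesis by simp
    qed
    \<comment> \<open>The recursion a(m+1) = r a(m) + d(m+1) r^(m+1) splits the increment into two
      parts, each at most C because |a(m)| is at most C/(1 - r).\<close>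
    have a_step: "norm (a (Suc m) - a m) \<le> 2 * C" for m
    proof -
      have "a (Suc m) - a m = d (Suc m) * of_real (r ^ Suc m) - of_real (1 - r) * a m"
        by (simp add: a_def S_def algebra_simps)
      also have "norm \<dots> \<le> norm (d (Suc m)) * r ^ Suc m + (1 - r) * norm (a m)"
        using norm_triangle_ineq4[of "d (Suc m) * of_real (r ^ Suc m)" "of_real (1 - r) * a m"] r
        by (simp add: norm_mult norm_power del: of_real_diff)
      also have "norm (d (Suc m)) * r ^ Suc m \<le> C * 1"
        using d r C by (intro mult_mono power_le_one) auto
      also have "(1 - r) * norm (a m) \<le> (1 - r) * (C / (1 - r))"
        using a_bd' r by (intro mult_left_mono) auto
      finally show ?thesis using r by simp
    qed

    define z where "z t = exp (- of_real v + \<i> * of_real t)" for t :: real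
    define X where "X t = (\<Sum>j. d j * z t ^ j) / (1 - z t)" for t
    have z: "norm (z t) = r" for t by (simp add: z_def r_def)
    have z_pow: "S m * z t ^ m = a m * exp (\<i> * of_real (real m * t))" for m t
    proof -
      have "exp (\<i> * of_real (real m * t)) = exp (\<i> * of_real t) ^ m"
        by (simp add: mult_ac flip: exp_of_nat_mult)
      moreover have "z t = of_real r * exp (\<i> * of_real t)"
        unfolding z_def r_def exp_add by (simp flip: exp_of_real)
      ultimately show ?thesis by (simp add: a_def power_mult_distrib)
    qed
    have sm_dz: "summable (\<lambda>j. norm (d j * z t ^ j))" for t
    proof (rule summable_comparison_test')
      show "summable (\<lambda>j. C * r ^ j)" using r by (intro summable_mult summable_geometric) auto
      show "norm (norm (d j * z t ^ j)) \<le> C * r ^ j" for j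
        using mult_right_mono[OF d, of "r ^ j" j] r by (simp add: norm_mult norm_power z)
    qed
    have "(\<lambda>m. S m * z t ^ m) sums X t" for t
      unfolding S_def X_def using r by (intro partial_sums_mult_power_sums sm_dz) (simp add: z)
    then have X_sums: "(\<lambda>m. a m * exp (\<i> * of_real (real m * t))) sums X t" for t
      by (simp only: z_pow)
    \<comment> \<open>At t = 0 the phase is 1, so these terms are exactly
      \<open>a m\<close>.\<close>
    have "summable (\<lambda>m. norm (S m * z 0 ^ m))"
      unfolding S_def using r by (intro summable_norm_partial_sums_mult_power sm_dz) (simp add: z)
    then have sm_a: "summable (\<lambda>m. norm (a m))"
      by (simp add: z_pow)
    have X_bd: "norm (X t) \<le> 4 * M / (v + \<bar>t\<bar>)" if t: "\<bar>t\<bar> \<le> \<delta>" for t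
    proof -
      \<comment> \<open>Here 1 - z = 1 - e^(-w) has modulus at least |w|/2, hence at least (v +
        |t|)/4; \<delta> \<le> 1/8 ensures |w| \<le> 1/4.\<close>
      define w where "w = complex_of_real v - \<i> * of_real t"
      have "Re w = v" "Im w = - t" by (simp_all add: w_def)
      then have w: "v + \<bar>t\<bar> \<le> 2 * norm w" "norm w \<le> 1/4"
        using abs_Re_le_cmod[of w] abs_Im_le_cmod[of w] cmod_le[of w] v t \<delta> by auto
      have "z t = exp (- w)" by (simp add: z_def w_def)
      then have "(v + \<bar>t\<bar>) / 4 \<le> norm (1 - z t)"
        using norm_one_minus_exp_minus(3)[OF w(2)] w(1) by simp
      then have "norm (\<Sum>j. d j * z t ^ j) / norm (1 - z t) \<le> M / ((v + \<bar>t\<bar>) / 4)"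
        using M[OF v t] v \<open>M \<ge> 0\<close> unfolding z_def[symmetric] by (intro frac_le) auto
      then show ?thesis by (simp add: X_def norm_divide mult.commute)
    qed

    \<comment> \<open>Rotating by e^(-int) and e^(int) centres the frequencies at \<open>n\<close>;
      adding the values at t and -t leaves 2 cos((m - n)t).\<close>
    define G where "G t = exp (- (\<i> * of_real (real n * t))) * X t
      + exp (\<i> * of_real (real n * t)) * X (- t)" for t
    have G_sums: "(\<lambda>m. a m * of_real (2 * cos (real ((m - n) + (n - m)) * t))) sums G t" for t
    proof -
      have cos_eq: "exp (\<i> * of_real ((real m - real n) * t)) + exp (- (\<i> * of_real ((real m - real n) * t)))
          = of_real (2 * cos (real ((m - n) + (n - m)) * t))" for m
      proof -
        have "cos (real ((m - n) + (n - m)) * t) = cos ((real m - real n) * t)"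
          using cos_minus[of "(real m - real n) * t"]
          by (cases "n \<le> m") (auto simp: of_nat_diff algebra_simps)
        then show ?thesis
          by (simp add: cos_exp_eq flip: cos_of_real)
      qed
      have "a m * of_real (2 * cos (real ((m - n) + (n - m)) * t))
          = exp (- (\<i> * of_real (real n * t))) * (a m * exp (\<i> * of_real (real m * t)))
          + exp (\<i> * of_real (real n * t)) * (a m * exp (\<i> * of_real (real m * - t)))" for m
        unfolding cos_eq[symmetric]
        by (simp add: algebra_simps flip: exp_add)
      then show ?thesis
        unfolding G_def
        using sums_add[OF sums_mult[OF X_sums[of t]] sums_mult[OF X_sums[of "-t"]]] by simp
    qed
    have G_bd: "norm (G t) \<le> 8 * M / (v + t)" if "t \<in> {0..\<delta>}" for t
    proof -
      have "norm (G t) \<le> norm (X t) + norm (X (- t))"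
        unfolding G_def
        using norm_triangle_ineq[of "exp (- (\<i> * of_real (real n * t))) * X t"
            "exp (\<i> * of_real (real n * t)) * X (- t)"]
        by (simp add: norm_mult)
      also have "\<dots> \<le> 4 * M / (v + t) + 4 * M / (v + t)"
        using X_bd[of t] X_bd[of "-t"] that by (intro add_mono) auto
      finally show ?thesis by (simp add: add_divide_distrib[symmetric])
    qed

    have ln_bd: "ln ((v + \<delta>) / v) \<le> 2 / e * real n powr e"
    proof -
      have "(v + \<delta>) / v = 1 + real n * \<delta>"
        using n by (simp add: v_def field_simps)
      also have "real n * \<delta> \<le> real n * 1"
        using \<delta> by (intro mult_left_mono) auto
      then have "1 + real n * \<delta> \<le> 2 * real n" using n real_of_nat_ge_one_iff[of n] by linarith
      finally have "ln ((v + \<delta>) / v) \<le> ln (2 * real n)"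
        using v \<delta> by (intro ln_mono) auto
      also have "\<dots> \<le> (2 * real n) powr e / e"
        using n e by (intro ln_powr_bound) auto
      also have "\<dots> = 2 powr e / e * real n powr e" by (simp add: powr_mult)
      also have "\<dots> \<le> 2 powr 1 / e * real n powr e"
        using e by (intro mult_right_mono divide_right_mono powr_mono) auto
      finally show ?thesis by simp
    qed
    have "\<delta>\<^sup>2 * norm (a n) \<le> \<delta> * (8 * M) * ln ((v + \<delta>) / v) + 16 * (2 * C) * real n powr e * Z"
      unfolding Z_def using a_bd v \<delta> e n
      by (intro tent_localisation[OF sm_a a_step _ _ _ _ _ _ G_sums G_bd]) auto
    also have "\<dots> \<le> \<delta> * (8 * M) * (2 / e * real n powr e) + 16 * (2 * C) * real n powr e * Z"
      using \<open>M \<ge> 0\<close> \<delta> ln_bd by (intro add_right_mono mult_left_mono) auto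
    also have "\<dots> = (\<delta> * (8 * M) * (2 / e) + 32 * C * Z) * real n powr e"
      by (simp add: algebra_simps)
    finally have "norm (a n) \<le> (\<delta> * (8 * M) * (2 / e) + 32 * C * Z) * real n powr e / \<delta>\<^sup>2"
      using \<delta> by (simp add: pos_le_divide_eq mult.commute)
    then have "exp 1 * norm (a n)
        \<le> exp 1 * ((\<delta> * (8 * M) * (2 / e) + 32 * C * Z) * real n powr e / \<delta>\<^sup>2)"
      by (intro mult_left_mono) auto
    \<comment> \<open>The choice v = 1/n makes the damping at index \<open>n\<close> independent of
      \<open>n\<close>.\<close>
    moreover have "r ^ n = exp (- 1)"
      using n by (simp add: r_def v_def flip: exp_of_nat_mult)
    then have "norm (a n) = norm (S n) * exp (- 1)"
      unfolding a_def norm_mult norm_of_real by simp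
    then have "norm (S n) = exp 1 * norm (a n)"
      by (simp add: exp_minus)
    ultimately show ?thesis
      by (simp add: K_def)
  qed
  show ?thesis
  proof (rule bigoI)
    have "\<forall>\<^sub>F n in sequentially. 1 / real n < \<delta>"
      using lim_1_over_n \<delta>(1) order_tendstoD(2) by blast
    then show "\<forall>\<^sub>F n in sequentially. norm (norm (\<Sum>j<n. d j)) \<le> (K + C) * norm (real n powr e)"
      using eventually_gt_at_top[of 0]
    proof eventually_elim
      case (elim n)
      \<comment> \<open>\<open>S n\<close> has one term too many, \<open>d n\<close>, which accounts
        for the extra \<open>C\<close>.\<close>
      have "norm (norm (\<Sum>j<n. d j)) \<le> norm (S n) + norm (d n)"
        using norm_triangle_ineq4[of "S n" "d n"] by (simp add: S_def)
      also have "\<dots> \<le> K * real n powr e + C * 1"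
        using main[of n] elim d[of n] by simp
      also have "C * 1 \<le> C * real n powr e"
        using elim e C by (intro mult_left_mono ge_one_powr_ge_zero) auto
      finally show ?case by (simp add: algebra_simps)
    qed
  qed
qed

section \<open>Subtracting the singular terms and collecting the errors\<close>

theorem theorem1p7:
  fixes \<Phi> :: "complex \<Rightarrow> complex" and u :: "nat \<Rightarrow> complex"
    and k :: nat and \<gamma> A :: "nat \<Rightarrow> real" and \<epsilon> :: real
  assumes series: "\<And>z. norm z < 1 \<Longrightarrow> (\<lambda>j. u j * z ^ j) sums \<Phi> z"
    and coeffs: "u \<in> O(\<lambda>_. 1)"
    and exponents: "\<And>r. r \<in> {1..k} \<Longrightarrow> 0 < \<gamma> r \<and> \<gamma> r < 1"
    and decreasing: "\<And>r s. r \<in> {1..k} \<Longrightarrow> s \<in> {1..k} \<Longrightarrow> r < s \<Longrightarrow> \<gamma> r > \<gamma> s"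
    and expansion:
      "(\<lambda>(v, \<theta>). \<Phi> (exp (- complex_of_real v + \<i> * complex_of_real \<theta>))
          - (\<Sum>r=1..k. complex_of_real (A r)
               * (complex_of_real v - \<i> * complex_of_real \<theta>) powr (- complex_of_real (\<gamma> r))))
        \<in> O[at_right (0::real) \<times>\<^sub>F nhds (0::real)](\<lambda>_. 1)"
    and eps: "\<epsilon> > 0"
  shows "(\<lambda>n. norm ((\<Sum>j<n. u j)
            - complex_of_real (\<Sum>r=1..k. A r / Gamma (1 + \<gamma> r) * real n powr \<gamma> r)))
          \<in> O(\<lambda>n. real n powr \<epsilon>)"
proof -
  obtain C where C: "norm (u j) \<le> C" for j
  proof -
    \<comment> \<open>The O-bound holds only eventually; \<open>Bseq\<close> absorbs the finitely
      many earlier coefficients.\<close>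
    obtain c where "\<forall>\<^sub>F j in sequentially. norm (u j) \<le> c"
      using landau_o.bigE[OF coeffs] by auto
    then have "Bseq u" by (rule BfunI)
    then show ?thesis using that by (auto simp: Bseq_def)
  qed
  define c where "c r j = pochhammer (\<gamma> r) j / fact j" for r j
  define d where "d j = u j - (\<Sum>r=1..k. complex_of_real (A r) * of_real (c r j))" for j
  have d_bd: "norm (d j) \<le> C + (\<Sum>r=1..k. \<bar>A r\<bar>)" for j
  proof -
    have "norm (\<Sum>r=1..k. complex_of_real (A r) * of_real (c r j)) \<le> (\<Sum>r=1..k. \<bar>A r\<bar>)"
    proof (rule sum_norm_le)
      fix r assume "r \<in> {1..k}"
      then have "0 \<le> c r j" "c r j \<le> 1"
        unfolding c_def using exponents[of r] by (intro pochhammer_over_fact_le_1; simp)+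
      then have "\<bar>c r j\<bar> \<le> 1" by simp
      then have "\<bar>A r\<bar> * \<bar>c r j\<bar> \<le> \<bar>A r\<bar> * 1" by (intro mult_left_mono) auto
      then show "norm (complex_of_real (A r) * of_real (c r j)) \<le> \<bar>A r\<bar>"
        by (simp add: norm_mult)
    qed
    then show ?thesis
      unfolding d_def using C[of j] norm_triangle_ineq4 order.trans add_mono by meson
  qed

  define F where "F v \<theta> = \<Phi> (exp (- complex_of_real v + \<i> * complex_of_real \<theta>))
    - (\<Sum>r=1..k. complex_of_real (A r)
         * (complex_of_real v - \<i> * complex_of_real \<theta>) powr (- complex_of_real (\<gamma> r)))" for v \<theta>
  obtain M where "\<forall>\<^sub>F p in at_right 0 \<times>\<^sub>F nhds 0. norm (case p of (v, \<theta>) \<Rightarrow> F v \<theta>) \<le> M"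
    using landau_o.bigE[OF expansion] by (auto simp: F_def)
  then obtain P Q where P: "\<forall>\<^sub>F v in at_right 0. P v" and Q: "\<forall>\<^sub>F \<theta> in nhds 0. Q \<theta>"
    and PQ: "\<And>v \<theta>. P v \<Longrightarrow> Q \<theta> \<Longrightarrow> norm (F v \<theta>) \<le> M"
    by (auto simp: eventually_prod_filter)
  obtain b where b: "b > 0" "\<And>v. 0 < v \<Longrightarrow> v < b \<Longrightarrow> P v"
    using P by (auto simp: eventually_at_right_field)
  obtain b' where b': "b' > 0" "\<And>\<theta>. \<bar>\<theta>\<bar> < b' \<Longrightarrow> Q \<theta>"
    using Q by (auto simp: eventually_nhds_metric dist_real_def)
  \<comment> \<open>Halving \<open>b'\<close> turns |t| \<le> \<delta> into the strict inequality
    needed for \<open>Q\<close>; 1/8 is the radius required by the previous lemma.\<close>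
  define \<delta> where "\<delta> = min (1/8) (min b (b' / 2))"
  have \<delta>: "0 < \<delta>" "\<delta> \<le> 1/8" "\<delta> \<le> b" "\<delta> < b'" using b b' by (auto simp: \<delta>_def)

  have near_1: "norm (\<Sum>j. d j * exp (- of_real v + \<i> * of_real t) ^ j) \<le> M + (\<Sum>r=1..k. \<bar>A r\<bar> * 8)"
    if v: "0 < v" "v < \<delta>" and t: "\<bar>t\<bar> \<le> \<delta>" for v t
  proof -
    define w where "w = complex_of_real v - \<i> * of_real t"
    have w_parts: "Re w = v" "Im w = - t" by (simp_all add: w_def)
    then have w: "Re w > 0" "norm w \<le> 1/4"
      using cmod_le[of w] v t \<delta> by auto
    define z where "z = exp (- w)"
    have z_eq: "exp (- of_real v + \<i> * of_real t) = z" by (simp add: z_def w_def)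
    have "norm z < 1" using w by (simp add: z_def)
    then have "(\<lambda>j. \<Sum>r=1..k. complex_of_real (A r) * (of_real (c r j) * z ^ j))
        sums (\<Sum>r=1..k. complex_of_real (A r) * (1 - z) powr (- of_real (\<gamma> r)))"
      unfolding c_def by (intro sums_sum sums_mult pochhammer_sums_one_minus_powr)
    from sums_diff[OF series[OF \<open>norm z < 1\<close>] this]
    have "(\<lambda>j. u j * z ^ j - (\<Sum>r=1..k. complex_of_real (A r) * (of_real (c r j) * z ^ j)))
        sums (\<Phi> z - (\<Sum>r=1..k. complex_of_real (A r) * (1 - z) powr (- of_real (\<gamma> r))))" .
    then have "(\<lambda>j. d j * z ^ j)
        sums (\<Phi> z - (\<Sum>r=1..k. complex_of_real (A r) * (1 - z) powr (- of_real (\<gamma> r))))"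
      by (simp add: d_def algebra_simps sum_distrib_left sum_distrib_right)
    \<comment> \<open>The expansion is in powers of w and the subtracted series in powers of 1 - z;
      each exchange costs at most 8|A_r|.\<close>
    also have "\<Phi> z - (\<Sum>r=1..k. complex_of_real (A r) * (1 - z) powr (- of_real (\<gamma> r)))
        = F v t + (\<Sum>r=1..k. complex_of_real (A r)
            * (w powr (- of_real (\<gamma> r)) - (1 - z) powr (- of_real (\<gamma> r))))"
      unfolding F_def z_eq w_def[symmetric] by (simp add: right_diff_distrib sum_subtractf)
    finally have "(\<Sum>j. d j * z ^ j) = F v t + (\<Sum>r=1..k. complex_of_real (A r)
            * (w powr (- of_real (\<gamma> r)) - (1 - z) powr (- of_real (\<gamma> r))))"
      by (simp add: sums_iff)
    moreover have "norm (F v t) \<le> M"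
      using v t \<delta> by (intro PQ b b') auto
    moreover have "norm (\<Sum>r=1..k. complex_of_real (A r)
        * (w powr (- of_real (\<gamma> r)) - (1 - z) powr (- of_real (\<gamma> r)))) \<le> (\<Sum>r=1..k. \<bar>A r\<bar> * 8)"
      unfolding z_def using exponents w
      by (intro sum_norm_le) (auto simp: norm_mult intro!: mult_left_mono norm_powr_minus_diff_le)
    ultimately show ?thesis
      unfolding z_eq by (simp only: norm_triangle_mono)
  qed

  \<comment> \<open>The bound on the partial sums of \<open>d\<close> requires an exponent below 1;
    a larger \<epsilon> follows by monotonicity.\<close>
  define e where "e = min \<epsilon> (1/2)"
  have e: "0 < e" "e < 1" "e \<le> \<epsilon>" using eps by (auto simp: e_def)
  have "(\<lambda>n. norm (\<Sum>j<n. d j)) \<in> O(\<lambda>n. real n powr e)"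
    by (rule partial_sums_bigo_of_bounded_near_1[OF d_bd \<delta>(1,2) near_1 e(1,2)])
  also have "(\<lambda>n. real n powr e) \<in> O(\<lambda>n. real n powr \<epsilon>)"
    using e by (intro bigoI[of _ 1] eventually_mono[OF eventually_gt_at_top[of 0]])
      (auto intro!: powr_mono)
  finally have D: "(\<lambda>n. norm (\<Sum>j<n. d j)) \<in> O(\<lambda>n. real n powr \<epsilon>)" .

  \<comment> \<open>The error of replacing the partial binomial sums by their leading powers, which
    is O(1).\<close>
  define E where "E n = (\<Sum>r=1..k. A r * ((\<Sum>j<n. c r j) - real n powr \<gamma> r / Gamma (1 + \<gamma> r)))"
    for n :: nat
  have "E \<in> O(\<lambda>_. 1 :: real)"
  proof (rule bigoI)
    show "\<forall>\<^sub>F n in sequentially. norm (E n) \<le> (\<Sum>r=1..k. \<bar>A r\<bar> * (1 / Gamma (1 + \<gamma> r))) * norm (1 :: real)"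
      using eventually_gt_at_top[of 0]
    proof eventually_elim
      case (elim n)
      have "norm (\<Sum>r=1..k. A r * ((\<Sum>j<n. c r j) - real n powr \<gamma> r / Gamma (1 + \<gamma> r)))
          \<le> (\<Sum>r=1..k. \<bar>A r\<bar> * (1 / Gamma (1 + \<gamma> r)))"
        unfolding c_def using exponents elim
        by (intro sum_norm_le, unfold real_norm_def abs_mult)
           (intro mult_left_mono sum_pochhammer_asymptotic, auto)
      then show ?case by (simp only: E_def real_norm_def abs_one mult_1_right)
    qed
  qed
  also have "(\<lambda>_::nat. 1 :: real) \<in> O(\<lambda>n. real n powr \<epsilon>)"
    using eps by (intro bigoI[of _ 1] eventually_mono[OF eventually_gt_at_top[of 0]])
      (auto intro!: ge_one_powr_ge_zero)
  finally have E: "E \<in> O(\<lambda>n. real n powr \<epsilon>)" .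
  have "(\<Sum>j<n. u j) - complex_of_real (\<Sum>r=1..k. A r / Gamma (1 + \<gamma> r) * real n powr \<gamma> r)
      = (\<Sum>j<n. d j) + of_real (E n)" for n
  proof -
    have "(\<Sum>j<n. \<Sum>r=1..k. complex_of_real (A r) * of_real (c r j))
        = (\<Sum>r=1..k. \<Sum>j<n. complex_of_real (A r) * of_real (c r j))"
      by (rule sum.swap)
    also have "\<dots> = complex_of_real (\<Sum>r=1..k. A r * (\<Sum>j<n. c r j))"
      by (simp add: sum_distrib_left)
    finally have "(\<Sum>j<n. d j) = (\<Sum>j<n. u j) - complex_of_real (\<Sum>r=1..k. A r * (\<Sum>j<n. c r j))"
      by (simp add: d_def sum_subtractf)
    moreover have "E n = (\<Sum>r=1..k. A r * (\<Sum>j<n. c r j))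
        - (\<Sum>r=1..k. A r / Gamma (1 + \<gamma> r) * real n powr \<gamma> r)"
      unfolding E_def sum_subtractf[symmetric] by (simp add: right_diff_distrib)
    ultimately show ?thesis by simp
  qed
  then have "(\<lambda>n. norm ((\<Sum>j<n. u j)
      - complex_of_real (\<Sum>r=1..k. A r / Gamma (1 + \<gamma> r) * real n powr \<gamma> r)))
      \<in> O(\<lambda>n. norm (\<Sum>j<n. d j) + \<bar>E n\<bar>)"
    using norm_triangle_ineq[of "\<Sum>j<n. d j" "of_real (E n)" for n]
    by (intro landau_o.big_mono always_eventually allI) simp
  moreover have "(\<lambda>n. norm (\<Sum>j<n. d j) + \<bar>E n\<bar>) \<in> O(\<lambda>n. real n powr \<epsilon>)"
    using D E by (intro sum_in_bigo) auto
  ultimately show ?thesis by (rule landau_o.big_trans)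
qed

end
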